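(* Let $n>0$. The set $\mathcal{SP}a'(n)$ of modified semi-Padovan partitions of $n$ consists of all partitions $\lambda$ of $n$ satisfying the following two conditions: (a) $v_1(\lambda)$ has multiplicity one in $v(\lambda)$; (b) if $1<j\leq \ell(\lambda)$, then $v_j(\lambda)$ has multiplicity three in $v(\lambda)$ and $\lambda$ has at least two parts equal to $2^{v_j(\lambda)}$.
   Context: A partition of $n$ is a weakly decreasing sequence (equivalently, a finite multiset) of positive integers with sum $n$; its length $\ell(\lambda)$ is its number of parts. $\mathrm{val}_2(m)$ is the $2$-adic valuation of the positive integer $m$. For a partition $\lambda=(\lambda_1,\ldots,\lambda_{\ell(\lambda)})$, $v(\lambda)=(v_1(\lambda),\ldots,v_{\ell(\lambda)}(\lambda))$ is the sequence obtained by arranging the numbers $\mathrm{val}_2(\lambda_i)$, $1\le i\le \ell(\lambda)$, in non-increasing order; multiplicity in $v(\lambda)$ is the number of occurrences in this sequence. Notation: $\lambda\sqcup\mu$ is the partition whose multiset of parts is the multiset union (multiplicities added) of the parts of $\lambda$ and $\mu$; $2\lambda$ is obtained by doubling every part of $\lambda$; if $\lambda$ has an odd part, $\lambda^{o+2}$ is obtained by adding $2$ to (one occurrence of) the largest odd part of $\lambda$. For a set $\mathcal S$ of partitions these operations are applied elementwise (giving $\emptyset$ if $\mathcal S=\emptyset$). The modified semi-Padovan partitions are defined recursively by $\mathcal{SP}a'(0)=\emptyset$, $\mathcal{SP}a'(1)=\{(1)\}$, and for $n\ge1$: $\mathcal{SP}a'(2n)=2\,\mathcal{SP}a'(n)$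 and $\mathcal{SP}a'(2n+1)=\mathcal{SP}a'(2n-1)^{o+2}\cup\big(\mathcal{SP}a'(2n-2)\sqcup(1,1,1)\big)$. *)

theory Defs
  imports "HOL-Library.Multiset" "HOL-Computational_Algebra.Primes"
begin

text \<open>A partition is represented by the finite multiset of its parts, so that its length is
  \<open>size\<close> and \<open>\<squnion>\<close> is multiset addition.\<close>

definition partition_of :: "nat \<Rightarrow> nat multiset \<Rightarrow> bool" where
  "partition_of n \<mu> \<longleftrightarrow> (\<forall>x \<in># \<mu>. 0 < x) \<and> \<Sum>\<^sub># \<mu> = n"

definition double_parts :: "nat multiset \<Rightarrow> nat multiset" where
  "double_parts \<mu> = image_mset (\<lambda>x. 2 * x) \<mu>"

text \<open>Only meaningful if \<open>\<mu>\<close> has an odd part, as does every partition of an odd number;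
  otherwise \<open>Max\<close> is taken of the empty set.\<close>

definition largest_odd_add2 :: "nat multiset \<Rightarrow> nat multiset" where
  "largest_odd_add2 \<mu> =
     (let m = Max {x. x \<in># \<mu> \<and> odd x} in add_mset (m + 2) (\<mu> - {#m#}))"

function SPa' :: "nat \<Rightarrow> nat multiset set" where
  "SPa' 0 = {}"
| "SPa' (Suc 0) = {{#1#}}"
| "n \<ge> 1 \<Longrightarrow> SPa' (2 * n) = double_parts ` SPa' n"
| "n \<ge> 1 \<Longrightarrow> SPa' (2 * n + 1) =
     largest_odd_add2 ` SPa' (2 * n - 1) \<union> (\<lambda>\<mu>. \<mu> + {#1, 1, 1#}) ` SPa' (2 * n - 2)"
proof (goal_cases)
  case (1 P x)
  have "x = 0 \<or> x = Suc 0 \<or> (\<exists>n\<ge>1. x = 2 * n) \<or> (\<exists>n\<ge>1. x = 2 * n + 1)"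
    by presburger
  with 1 show P by blast
next
  case (7 n)
  have "Suc 0 \<noteq> 2 * n" by presburger
  from this 7(2) show ?case by (rule notE)
next
  case (8 n)
  have "n = 0" using 8(2) by simp
  then show ?case using 8(1) by simp
next
  case (10 n m)
  have "2 * n \<noteq> 2 * m + 1" by presburger
  from this 10(3) show ?case by (rule notE)
next
  case (9 n m)
  then have "n = m" by simp
  then show ?case by (rule arg_cong)
next
  case (11 n m)
  then have "n = m" by simp
  then show ?case by (rule arg_cong)
qed simp_all
termination
  by (relation "measure id") auto

text \<open>The numbers \<open>val\<^sub>2(x)\<close>, for \<open>x\<close> a part of \<open>\<mu>\<close>, in non-increasing order.  List positions
  start at 0, so the entry \<open>v\<^sub>j(\<mu>)\<close>, numbered from 1, is \<open>val2_seq \<mu> ! (j - 1)\<close>.\<close>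

definition val2_seq :: "nat multiset \<Rightarrow> nat list" where
  "val2_seq \<mu> = rev (sorted_list_of_multiset (image_mset (multiplicity 2) \<mu>))"

definition val2_entry :: "nat multiset \<Rightarrow> nat \<Rightarrow> nat" where
  "val2_entry \<mu> j = val2_seq \<mu> ! (j - 1)"

end

theory Submission
  imports Defs
begin

text \<open>The valuation condition only concerns the multiset of valuations: some value \<open>M\<close> is attained
  by exactly one part, and every other value is smaller than \<open>M\<close> and attained by exactly three
  parts, two of which are the bare power of two.  The predicate \<open>semi_padovan\<close> says this without
  mentioning an ordering of the parts, and \<open>semi_padovan_iff_val2_seq\<close> translates it.

  The recursion peels off the smallest valuation.  The number of odd parts is the multiplicity of
  the valuation \<open>0\<close>, so it is 0, 1 or 3, and it has the parity of \<open>n\<close>.  If \<open>n\<close> is even there is no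
  odd part, and halving all parts shifts all valuations down by one.  If \<open>n\<close> is odd there are two
  possibilities.  A single odd part can only have the maximal valuation \<open>M = 0\<close>, so the partition is
  \<open>(n)\<close>.  Three odd parts must be \<open>1, 1, k\<close> with \<open>k\<close> odd, and the remaining parts are even and again
  satisfy the condition.  Hence for odd \<open>n\<close> the partitions are \<open>(n)\<close> and those of the form
  \<open>(1, 1, k) \<squnion> \<nu>\<close> (lemma \<open>semi_padovan_partitions_odd\<close>).  In both forms adding 2 to the largest odd
  part increases that single part or \<open>k\<close>.  So if \<open>n \<ge> 3\<close>, everything is reached in this way from a
  partition of \<open>n - 2\<close>, except for the partitions with \<open>k = 1\<close>, which are supplied by \<open>\<nu> \<squnion> (1, 1, 1)\<close>.
  This is the recursion defining \<open>SPa'\<close>.\<close>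

section \<open>The valuation condition on multisets\<close>

abbreviation val2_mset :: "nat multiset \<Rightarrow> nat multiset" where
  "val2_mset \<mu> \<equiv> image_mset (multiplicity 2) \<mu>"

definition semi_padovan :: "nat multiset \<Rightarrow> bool" where
  "semi_padovan \<mu> \<longleftrightarrow> (\<exists>M. count (val2_mset \<mu>) M = 1 \<and>
     (\<forall>v \<in># val2_mset \<mu>. v \<noteq> M \<longrightarrow>
        v < M \<and> count (val2_mset \<mu>) v = 3 \<and> count \<mu> (2 ^ v) \<ge> 2))"

definition semi_padovan_partitions :: "nat \<Rightarrow> nat multiset set" where
  "semi_padovan_partitions n = {\<mu>. partition_of n \<mu> \<and> semi_padovan \<mu>}"

lemma semi_padovan_imp_nonempty: "semi_padovan \<mu> \<Longrightarrow> \<mu> \<noteq> {#}"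
  by (auto simp: semi_padovan_def)

lemma count_list_ge_2:
  assumes "i < length xs" "j < length xs" "i \<noteq> j" "xs ! i = xs ! j"
  shows "count_list xs (xs ! i) \<ge> 2"
proof -
  have "{i, j} \<subseteq> {k. k < length xs \<and> xs ! i = xs ! k}"
    using assms by auto
  from card_mono[OF _ this] assms(3) show ?thesis
    by (simp add: count_list_eq_length_filter length_filter_conv_card)
qed

text \<open>Since the first entry of a non-increasing sequence is its maximum, it is the only candidate for
  \<open>M\<close>; and if its multiplicity is one, the entries at later positions are exactly the other values.\<close>

lemma semi_padovan_iff_val2_seq:
  "semi_padovan \<mu> \<longleftrightarrow>
     count_list (val2_seq \<mu>) (val2_entry \<mu> 1) = 1 \<and>
     (\<forall>j. 1 < j \<and> j \<le> size \<mu> \<longrightarrow>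
        count_list (val2_seq \<mu>) (val2_entry \<mu> j) = 3 \<and> count \<mu> (2 ^ val2_entry \<mu> j) \<ge> 2)"
proof (cases "\<mu> = {#}")
  case True
  then show ?thesis by (simp add: semi_padovan_def val2_seq_def)
next
  case False
  define xs where "xs = val2_seq \<mu>"
  have mset_xs: "mset xs = val2_mset \<mu>"
    by (simp add: xs_def val2_seq_def)
  have len: "length xs = size \<mu>"
    using arg_cong[OF mset_xs, of size] by simp
  have count_xs: "count (val2_mset \<mu>) v = count_list xs v" for v
    by (simp add: mset_xs[symmetric] count_mset)
  have set_xs: "set_mset (val2_mset \<mu>) = set xs"
    by (metis mset_xs set_mset_mset)
  have pos: "0 < length xs"
    using False len by (simp add: nonempty_has_size)
  have hd_in: "xs ! 0 \<in> set xs"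
    using pos by (rule nth_mem)
  have sorted: "sorted (rev xs)"
    by (simp add: xs_def val2_seq_def)
  have max: "v \<le> xs ! 0" if "v \<in> set xs" for v
  proof -
    obtain i where "i < length xs" "v = xs ! i"
      using \<open>v \<in> set xs\<close> by (metis in_set_conv_nth)
    then show ?thesis
      using sorted_rev_nth_mono[OF sorted, of 0 i] by simp
  qed
  have "semi_padovan \<mu> \<longleftrightarrow> count_list xs (xs ! 0) = 1 \<and>
     (\<forall>j. 1 < j \<and> j \<le> size \<mu> \<longrightarrow>
        count_list xs (xs ! (j - 1)) = 3 \<and> count \<mu> (2 ^ (xs ! (j - 1))) \<ge> 2)"
    (is "_ \<longleftrightarrow> ?first \<and> ?rest")
  proof
    assume "semi_padovan \<mu>"
    then obtain M where M: "count_list xs M = 1"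
      and others: "\<And>v. v \<in> set xs \<Longrightarrow> v \<noteq> M \<Longrightarrow>
        v < M \<and> count_list xs v = 3 \<and> count \<mu> (2 ^ v) \<ge> 2"
      unfolding semi_padovan_def count_xs set_xs by blast
    have "M \<in> set xs"
      using M by (metis count_notin zero_neq_one)
    then have M_eq: "M = xs ! 0"
      using max[of M] others[OF hd_in] by fastforce
    have ?rest
    proof (intro allI impI)
      fix j assume j: "1 < j \<and> j \<le> size \<mu>"
      then have "j - 1 < length xs" by (auto simp: len)
      moreover have "xs ! (j - 1) \<noteq> xs ! 0"
        using count_list_ge_2[of 0 xs "j - 1"] M M_eq pos j \<open>j - 1 < length xs\<close> by auto
      ultimately show "count_list xs (xs ! (j - 1)) = 3 \<and> count \<mu> (2 ^ (xs ! (j - 1))) \<ge> 2"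
        using others M_eq by simp
    qed
    then show "?first \<and> ?rest" using M M_eq by simp
  next
    assume cond: "?first \<and> ?rest"
    have "v < xs ! 0 \<and> count_list xs v = 3 \<and> count \<mu> (2 ^ v) \<ge> 2"
      if v: "v \<in> set xs" "v \<noteq> xs ! 0" for v
    proof -
      obtain i where i: "i < length xs" "v = xs ! i"
        using v(1) by (auto simp: in_set_conv_nth)
      with v(2) have "i \<noteq> 0" by (metis)
      then have "1 < i + 1 \<and> i + 1 \<le> size \<mu>" using i(1) len by simp
      then have "count_list xs (xs ! (i + 1 - 1)) = 3 \<and> count \<mu> (2 ^ (xs ! (i + 1 - 1))) \<ge> 2"
        using cond by blast
      with max[OF v(1)] v(2) i(2) show ?thesis by simp
    qed
    with cond show "semi_padovan \<mu>"
      unfolding semi_padovan_def count_xs set_xs by blast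
  qed
  then show ?thesis
    by (simp add: val2_entry_def xs_def)
qed

section \<open>Even numbers: halving all parts\<close>

lemma val2_eq_0_iff: "0 < x \<Longrightarrow> multiplicity 2 x = 0 \<longleftrightarrow> odd (x :: nat)"
  by (simp add: multiplicity_eq_zero_iff)

lemma count_val2_mset_0:
  assumes "\<forall>x \<in># \<mu>. 0 < x"
  shows "count (val2_mset \<mu>) 0 = size (filter_mset odd \<mu>)"
  using assms by (induction \<mu>) (auto simp: val2_eq_0_iff)

lemma odd_sum_mset_iff: "odd (\<Sum>\<^sub># \<mu>) \<longleftrightarrow> odd (size (filter_mset odd (\<mu> :: nat multiset)))"
  by (induction \<mu>) auto

lemma val2_mset_double_parts:
  assumes "\<forall>x \<in># \<mu>. 0 < x"
  shows "val2_mset (double_parts \<mu>) = image_mset Suc (val2_mset \<mu>)"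
  using assms by (induction \<mu>) (auto simp: double_parts_def multiplicity_times_same)

lemma count_image_mset_injective: "inj f \<Longrightarrow> count (image_mset f \<mu>) (f x) = count \<mu> x"
  by (induction \<mu>) (auto simp: inj_eq)

lemma count_double_parts: "count (double_parts \<mu>) (2 * x) = count \<mu> x"
  unfolding double_parts_def by (rule count_image_mset_injective) (simp add: inj_def)

lemma partition_of_double_parts: "partition_of (2 * n) (double_parts \<mu>) \<longleftrightarrow> partition_of n \<mu>"
proof -
  have "\<Sum>\<^sub># (double_parts \<mu>) = 2 * \<Sum>\<^sub># \<mu>"
    by (induction \<mu>) (simp_all add: double_parts_def)
  then show ?thesis
    by (auto simp: partition_of_def double_parts_def)
qed

lemma double_parts_halve:
  assumes "\<forall>x \<in># \<mu>. even x"
  shows "double_parts (image_mset (\<lambda>x. x div 2) \<mu>) = \<mu>"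
  using assms by (induction \<mu>) (auto simp: double_parts_def)

lemma semi_padovan_double_parts:
  assumes "\<forall>x \<in># \<mu>. 0 < x"
  shows "semi_padovan (double_parts \<mu>) \<longleftrightarrow> semi_padovan \<mu>"
proof -
  have count_Suc: "count (val2_mset (double_parts \<mu>)) (Suc v) = count (val2_mset \<mu>) v" for v
    unfolding val2_mset_double_parts[OF assms] by (rule count_image_mset_injective) simp
  have count_0: "count (val2_mset (double_parts \<mu>)) 0 = 0"
    unfolding val2_mset_double_parts[OF assms] by (auto simp: count_eq_zero_iff)
  have count_pow: "count (double_parts \<mu>) (2 ^ Suc v) = count \<mu> (2 ^ v)" for v
    by (simp add: count_double_parts)
  have ex_Suc: "(\<exists>M. count (val2_mset (double_parts \<mu>)) M = 1 \<and> P M) \<longleftrightarrow>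
      (\<exists>M. count (val2_mset (double_parts \<mu>)) (Suc M) = 1 \<and> P (Suc M))" for P
    by (metis count_0 not0_implies_Suc zero_neq_one)
  have set_eq: "set_mset (val2_mset (double_parts \<mu>)) = Suc ` set_mset (val2_mset \<mu>)"
    by (simp add: val2_mset_double_parts[OF assms])
  show ?thesis
    unfolding semi_padovan_def ex_Suc set_eq ball_simps count_Suc count_pow by simp
qed

lemma semi_padovan_count_val2_0:
  assumes "semi_padovan \<mu>"
  shows "count (val2_mset \<mu>) 0 \<in> {0, 1, 3}"
proof -
  obtain M where "count (val2_mset \<mu>) M = 1"
    and "\<forall>v \<in># val2_mset \<mu>. v \<noteq> M \<longrightarrow> count (val2_mset \<mu>) v = 3"
    using assms unfolding semi_padovan_def by blast
  then show ?thesis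
    by (metis count_inI insertCI)
qed

text \<open>An even number of odd parts among the possible multiplicities 0, 1, 3 of the valuation \<open>0\<close>
  leaves only 0.\<close>

lemma semi_padovan_even_parts:
  assumes "even n" "\<mu> \<in> semi_padovan_partitions n"
  shows "\<forall>x \<in># \<mu>. even x"
proof -
  have pos: "\<forall>x \<in># \<mu>. 0 < x" and sum: "\<Sum>\<^sub># \<mu> = n" and sp: "semi_padovan \<mu>"
    using assms(2) by (auto simp: semi_padovan_partitions_def partition_of_def)
  have "even (size (filter_mset odd \<mu>))"
    using odd_sum_mset_iff[of \<mu>] assms(1) sum by simp
  with semi_padovan_count_val2_0[OF sp] have "filter_mset odd \<mu> = {#}"
    unfolding count_val2_mset_0[OF pos] by auto
  then show ?thesis
    by (metis count_empty count_filter_mset not_in_iff)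
qed

lemma semi_padovan_partitions_double:
  "semi_padovan_partitions (2 * n) = double_parts ` semi_padovan_partitions n"
proof (intro equalityI subsetI)
  fix \<mu> assume \<mu>: "\<mu> \<in> semi_padovan_partitions (2 * n)"
  define \<nu> where "\<nu> = image_mset (\<lambda>x. x div 2) \<mu>"
  have eq: "double_parts \<nu> = \<mu>"
    unfolding \<nu>_def using semi_padovan_even_parts[OF _ \<mu>] by (intro double_parts_halve) simp
  have "partition_of n \<nu>"
    using \<mu> eq partition_of_double_parts[of n \<nu>] by (simp add: semi_padovan_partitions_def)
  moreover from this have "semi_padovan \<nu>"
    using \<mu> eq semi_padovan_double_parts[of \<nu>]
    by (simp add: semi_padovan_partitions_def partition_of_def)
  ultimately show "\<mu> \<in> double_parts ` semi_padovan_partitions n"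
    using eq by (auto simp: semi_padovan_partitions_def)
next
  fix \<mu> assume "\<mu> \<in> double_parts ` semi_padovan_partitions n"
  then show "\<mu> \<in> semi_padovan_partitions (2 * n)"
    using partition_of_double_parts semi_padovan_double_parts
    by (auto simp: semi_padovan_partitions_def partition_of_def)
qed

section \<open>Odd numbers: the three odd parts\<close>

text \<open>The triple occupies the valuation \<open>0\<close>, which the even parts avoid.  It has multiplicity three,
  so it cannot take over the role of \<open>M\<close>, and it satisfies the condition imposed on the smaller
  valuations because \<open>2 ^ 0 = 1\<close> occurs twice.\<close>

lemma semi_padovan_add_odd_triple:
  assumes even: "\<forall>x \<in># \<nu>. 0 < x \<and> even x" and k: "odd k"
  shows "semi_padovan ({#1, 1, k#} + \<nu>) \<longleftrightarrow> semi_padovan \<nu>"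
proof -
  let ?\<mu> = "{#1, 1, k#} + \<nu>"
  have val_k: "multiplicity 2 k = 0"
    using k by (simp add: not_dvd_imp_multiplicity_0)
  have V: "val2_mset ?\<mu> = {#0, 0, 0#} + val2_mset \<nu>"
    by (simp add: val_k)
  have no_0: "0 \<notin># val2_mset \<nu>"
    using even by (auto simp: val2_eq_0_iff)
  then have count_0: "count (val2_mset \<nu>) 0 = 0"
    by (simp only: not_in_iff)
  have count_V: "count (val2_mset ?\<mu>) v = (if v = 0 then 3 else count (val2_mset \<nu>) v)" for v
    unfolding V using count_0 by simp
  have set_V: "set_mset (val2_mset ?\<mu>) = insert 0 (set_mset (val2_mset \<nu>))"
    unfolding V by simp
  have count_pow: "count ?\<mu> (2 ^ v) = count \<nu> (2 ^ v)" if "v \<noteq> 0" for v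
  proof -
    have "even (2 ^ v :: nat)"
      using that by simp
    then have "2 ^ v \<noteq> (1 :: nat)" "2 ^ v \<noteq> k"
      using k by (metis odd_one, metis)
    then show ?thesis by (simp del: One_nat_def)
  qed
  show ?thesis
  proof
    assume "semi_padovan ?\<mu>"
    then obtain M where M: "count (val2_mset ?\<mu>) M = 1"
      and others: "\<forall>v \<in># val2_mset ?\<mu>. v \<noteq> M \<longrightarrow>
        v < M \<and> count (val2_mset ?\<mu>) v = 3 \<and> count ?\<mu> (2 ^ v) \<ge> 2"
      unfolding semi_padovan_def by blast
    have M': "count (val2_mset \<nu>) M = 1"
      using M unfolding count_V by (simp split: if_splits)
    have "v < M \<and> count (val2_mset \<nu>) v = 3 \<and> count \<nu> (2 ^ v) \<ge> 2"
      if v: "v \<in># val2_mset \<nu>" "v \<noteq> M" for v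
    proof -
      have "v \<noteq> 0" using v(1) no_0 by metis
      moreover have "v \<in># val2_mset ?\<mu>" using v(1) unfolding set_V by blast
      ultimately show ?thesis
        using others v(2) count_V count_pow by metis
    qed
    with M' show "semi_padovan \<nu>"
      unfolding semi_padovan_def by blast
  next
    assume "semi_padovan \<nu>"
    then obtain M where M: "count (val2_mset \<nu>) M = 1"
      and others: "\<forall>v \<in># val2_mset \<nu>. v \<noteq> M \<longrightarrow>
        v < M \<and> count (val2_mset \<nu>) v = 3 \<and> count \<nu> (2 ^ v) \<ge> 2"
      unfolding semi_padovan_def by blast
    have "M \<noteq> 0" using M count_0 by (metis zero_neq_one)
    then have "count (val2_mset ?\<mu>) M = 1"
      using M unfolding count_V by simp
    moreover have "v < M \<and> count (val2_mset ?\<mu>) v = 3 \<and> count ?\<mu> (2 ^ v) \<ge> 2"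
      if v: "v \<in># val2_mset ?\<mu>" "v \<noteq> M" for v
    proof (cases "v = 0")
      case True
      then show ?thesis
        using \<open>M \<noteq> 0\<close> count_V[of v] by simp
    next
      case False
      then have "v \<in># val2_mset \<nu>" using v(1) unfolding set_V by blast
      then show ?thesis
        using others v(2) False count_V count_pow by metis
    qed
    ultimately show "semi_padovan ?\<mu>"
      unfolding semi_padovan_def by blast
  qed
qed

lemma semi_padovan_singleton: "semi_padovan {#x#}"
  by (auto simp: semi_padovan_def)

text \<open>If a valuation \<open>0\<close> occurs, it is either the value \<open>M\<close>, and being maximal it is then the only
  valuation, or it is one of the values of multiplicity three.\<close>

lemma semi_padovan_odd_cases:
  assumes pos: "\<forall>x \<in># \<mu>. 0 < x" and sp: "semi_padovan \<mu>" and odd: "odd (\<Sum>\<^sub># \<mu>)"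
  obtains x where "\<mu> = {#x#}"
  | k \<nu> where "\<mu> = {#1, 1, k#} + \<nu>" "odd k" "\<forall>x \<in># \<nu>. even x"
proof -
  let ?O = "filter_mset odd \<mu>"
  obtain M where M: "count (val2_mset \<mu>) M = 1"
    and others: "\<forall>v \<in># val2_mset \<mu>. v \<noteq> M \<longrightarrow>
      v < M \<and> count (val2_mset \<mu>) v = 3 \<and> count \<mu> (2 ^ v) \<ge> 2"
    using sp unfolding semi_padovan_def by blast
  have "size ?O \<noteq> 0"
    using odd odd_sum_mset_iff by (metis even_zero)
  then have zero_in: "0 \<in># val2_mset \<mu>"
    using count_val2_mset_0[OF pos] by (metis not_in_iff)
  show ?thesis
  proof (cases "M = 0")
    case True
    then have "\<forall>v \<in># val2_mset \<mu>. v = 0"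
      using others by blast
    then have "val2_mset \<mu> = replicate_mset (size \<mu>) 0"
      by (metis set_mset_subset_singletonD singleton_iff size_image_mset subsetI)
    then have "size \<mu> = 1"
      using M True by simp
    then show ?thesis
      using that(1) size_1_singleton_mset by blast
  next
    case False
    then have three: "count (val2_mset \<mu>) 0 = 3" and two: "count \<mu> 1 \<ge> 2"
      using bspec[OF others zero_in] by auto
    have "{#1, 1#} \<subseteq># ?O"
      using two by (auto simp: subseteq_mset_def)
    then obtain \<rho> where \<rho>: "?O = {#1, 1#} + \<rho>"
      by (metis subset_mset.add_diff_inverse)
    have "size \<rho> = 1"
      using three arg_cong[OF \<rho>, of size] count_val2_mset_0[OF pos] by simp
    then obtain k where k: "\<rho> = {#k#}"
      using size_1_singleton_mset by blast
    have "k \<in># ?O" using \<rho> k by simp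
    then have "odd k" by simp
    have "\<mu> = ?O + filter_mset even \<mu>"
      using multiset_partition[of \<mu> odd] by simp
    then have "\<mu> = {#1, 1, k#} + filter_mset even \<mu>"
      unfolding \<rho> k by (simp add: add_mset_commute)
    then show ?thesis
      using \<open>odd k\<close> by (rule that(2)) simp
  qed
qed

lemma semi_padovan_partitions_odd:
  assumes "odd m"
  shows "semi_padovan_partitions m = insert {#m#}
    {{#1, 1, k#} + \<nu> | k l \<nu>.
       odd k \<and> even l \<and> k + l + 2 = m \<and> \<nu> \<in> semi_padovan_partitions l}"
    (is "_ = insert _ ?triples")
proof (intro equalityI subsetI)
  fix \<mu> assume "\<mu> \<in> semi_padovan_partitions m"
  then have pos: "\<forall>x \<in># \<mu>. 0 < x" and sum: "\<Sum>\<^sub># \<mu> = m" and sp: "semi_padovan \<mu>"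
    by (auto simp: semi_padovan_partitions_def partition_of_def)
  have "odd (\<Sum>\<^sub># \<mu>)" using sum assms by simp
  then show "\<mu> \<in> insert {#m#} ?triples"
  proof (rule semi_padovan_odd_cases[OF pos sp])
    fix x assume "\<mu> = {#x#}"
    then show ?thesis using sum by simp
  next
    fix k \<nu> assume \<mu>: "\<mu> = {#1, 1, k#} + \<nu>" and k: "odd k" and even: "\<forall>x \<in># \<nu>. even x"
    have sum': "k + \<Sum>\<^sub># \<nu> + 2 = m"
      using sum \<mu> by simp
    then have "even (\<Sum>\<^sub># \<nu>)"
      using assms k by presburger
    moreover have "semi_padovan \<nu>"
      using semi_padovan_add_odd_triple[of \<nu> k] sp pos even k \<mu> by simp
    then have "\<nu> \<in> semi_padovan_partitions (\<Sum>\<^sub># \<nu>)"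
      using pos \<mu> by (simp add: semi_padovan_partitions_def partition_of_def)
    ultimately show ?thesis
      using \<mu> k sum' by blast
  qed
next
  fix \<mu> assume "\<mu> \<in> insert {#m#} ?triples"
  then consider "\<mu> = {#m#}"
    | k l \<nu> where "\<mu> = {#1, 1, k#} + \<nu>" "odd k" "even l" "k + l + 2 = m"
        "\<nu> \<in> semi_padovan_partitions l"
    by blast
  then show "\<mu> \<in> semi_padovan_partitions m"
  proof cases
    case 1
    then show ?thesis
      using assms by (simp add: semi_padovan_partitions_def partition_of_def
          semi_padovan_singleton odd_pos)
  next
    case (2 k l \<nu>)
    then have pos: "\<forall>x \<in># \<nu>. 0 < x" and sum: "\<Sum>\<^sub># \<nu> = l" and sp: "semi_padovan \<nu>"
      by (auto simp: semi_padovan_partitions_def partition_of_def)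
    have "\<forall>x \<in># \<nu>. 0 < x \<and> even x"
      using pos semi_padovan_even_parts[OF 2(3,5)] by blast
    then have "semi_padovan \<mu>"
      using semi_padovan_add_odd_triple 2(1,2) sp by simp
    moreover have "partition_of m \<mu>"
      using 2(1,2,4) pos sum by (auto simp: partition_of_def odd_pos)
    ultimately show ?thesis
      by (simp add: semi_padovan_partitions_def)
  qed
qed

lemma largest_odd_add2_singleton: "odd k \<Longrightarrow> largest_odd_add2 {#k#} = {#k + 2#}"
proof -
  assume "odd k"
  then have "{x. x \<in># {#k#} \<and> odd x} = {k}"
    by auto
  then show ?thesis
    by (simp add: largest_odd_add2_def)
qed

lemma largest_odd_add2_odd_triple:
  assumes "odd k" "\<forall>x \<in># \<nu>. even x"
  shows "largest_odd_add2 ({#1, 1, k#} + \<nu>) = {#1, 1, k + 2#} + \<nu>"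
proof -
  have "{x. x \<in># {#1, 1, k#} + \<nu> \<and> odd x} = {1, k}"
    using assms by auto
  moreover have "Max {1, k} = k"
    using odd_pos[OF assms(1)] by simp
  ultimately show ?thesis
    by (simp add: largest_odd_add2_def Let_def add_mset_commute)
qed

text \<open>Among the forms in \<open>semi_padovan_partitions_odd\<close>, adding 2 to the largest odd part reaches
  \<open>{#2 * n + 1#}\<close> and all triples with third entry at least 3; adjoining \<open>(1, 1, 1)\<close> gives the
  triples with third entry 1.\<close>

lemma semi_padovan_partitions_odd_rec:
  assumes "n \<ge> 1"
  shows "semi_padovan_partitions (2 * n + 1) =
    largest_odd_add2 ` semi_padovan_partitions (2 * n - 1) \<union>
    (\<lambda>\<mu>. \<mu> + {#1, 1, 1#}) ` semi_padovan_partitions (2 * n - 2)"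
    (is "_ = ?A \<union> ?B")
proof -
  have odd1: "odd (2 * n + 1)" and odd2: "odd (2 * n - 1)" and even: "even (2 * n - 2)"
    using assms by auto
  note forms = semi_padovan_partitions_odd[OF odd1]
  note forms' = semi_padovan_partitions_odd[OF odd2]
  show ?thesis
  proof (intro equalityI subsetI)
    fix \<mu> assume "\<mu> \<in> semi_padovan_partitions (2 * n + 1)"
    then consider "\<mu> = {#2 * n + 1#}"
      | k l \<nu> where "\<mu> = {#1, 1, k#} + \<nu>" "odd k" "even l" "k + l + 2 = 2 * n + 1"
          "\<nu> \<in> semi_padovan_partitions l"
      unfolding forms by blast
    then show "\<mu> \<in> ?A \<union> ?B"
    proof cases
      case 1
      moreover have "2 * n - 1 + 2 = 2 * n + 1"
        using assms by simp
      ultimately have "\<mu> = largest_odd_add2 {#2 * n - 1#}"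
        using largest_odd_add2_singleton[OF odd2] by metis
      then show ?thesis unfolding forms' by blast
    next
      case (2 k l \<nu>)
      show ?thesis
      proof (cases "k = 1")
        case True
        then have "l = 2 * n - 2" using 2(4) by simp
        moreover have "\<mu> = \<nu> + {#1, 1, 1#}"
          using 2(1) True by simp
        ultimately show ?thesis using 2(5) by blast
      next
        case False
        then have k: "odd (k - 2)" "k - 2 + 2 = k" "k - 2 + l + 2 = 2 * n - 1"
          using 2(2,4) by presburger+
        have "\<mu> = largest_odd_add2 ({#1, 1, k - 2#} + \<nu>)"
          using largest_odd_add2_odd_triple[OF k(1) semi_padovan_even_parts[OF 2(3,5)]]
            k(2) 2(1) by simp
        moreover have "{#1, 1, k - 2#} + \<nu> \<in> semi_padovan_partitions (2 * n - 1)"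
          unfolding forms' using k(1,3) 2(3,5) by blast
        ultimately show ?thesis by blast
      qed
    qed
  next
    fix \<mu> assume "\<mu> \<in> ?A \<union> ?B"
    then consider "\<mu> = largest_odd_add2 {#2 * n - 1#}"
      | k l \<nu> where "\<mu> = largest_odd_add2 ({#1, 1, k#} + \<nu>)" "odd k" "even l"
          "k + l + 2 = 2 * n - 1" "\<nu> \<in> semi_padovan_partitions l"
      | \<nu> where "\<mu> = \<nu> + {#1, 1, 1#}" "\<nu> \<in> semi_padovan_partitions (2 * n - 2)"
      unfolding forms' by blast
    then show "\<mu> \<in> semi_padovan_partitions (2 * n + 1)"
    proof cases
      case 1
      moreover have "2 * n - 1 + 2 = 2 * n + 1"
        using assms by simp
      ultimately have "\<mu> = {#2 * n + 1#}"
        using largest_odd_add2_singleton[OF odd2] by metis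
      then show ?thesis unfolding forms by blast
    next
      case (2 k l \<nu>)
      have "\<mu> = {#1, 1, k + 2#} + \<nu>"
        using largest_odd_add2_odd_triple[OF 2(2) semi_padovan_even_parts[OF 2(3,5)]] 2(1) by simp
      moreover have "odd (k + 2)" "k + 2 + l + 2 = 2 * n + 1"
        using 2(2,4) by simp_all
      ultimately show ?thesis unfolding forms using 2(3,5) by blast
    next
      case (3 \<nu>)
      have "\<mu> = {#1, 1, 1#} + \<nu>" "odd (1 :: nat)" "1 + (2 * n - 2) + 2 = 2 * n + 1"
        using 3(1) assms by simp_all
      then show ?thesis unfolding forms using 3(2) even by blast
    qed
  qed
qed

section \<open>The modified semi-Padovan partitions\<close>

text \<open>Equality holds at 0 as well, where both sides are empty; the recursion for 3 refers to this
  value.\<close>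

lemma SPa'_eq_semi_padovan_partitions: "SPa' n = semi_padovan_partitions n"
proof (induction n rule: SPa'.induct)
  case 1
  have "\<mu> = {#}" if \<mu>: "partition_of 0 \<mu>" for \<mu>
  proof -
    have "x \<notin># \<mu>" for x
      using \<mu> by (auto simp: partition_of_def)
    then show ?thesis
      by (metis multiset_nonemptyE)
  qed
  then have "semi_padovan_partitions 0 = {}"
    unfolding semi_padovan_partitions_def using semi_padovan_imp_nonempty by blast
  then show ?case
    by (simp only: SPa'.simps(1))
next
  case 2
  show ?case
    using semi_padovan_partitions_odd[of 1] by simp
next
  case (3 n)
  then show ?case
    by (simp only: SPa'.simps(3) semi_padovan_partitions_double)
next
  case (4 n)
  then show ?case
    by (simp only: SPa'.simps(4) semi_padovan_partitions_odd_rec)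
qed

theorem theorem5p5:
  fixes n :: nat
  assumes "n > 0"
  shows "SPa' n =
    {\<mu>. partition_of n \<mu> \<and>
        count_list (val2_seq \<mu>) (val2_entry \<mu> 1) = 1 \<and>
        (\<forall>j. 1 < j \<and> j \<le> size \<mu> \<longrightarrow>
           count_list (val2_seq \<mu>) (val2_entry \<mu> j) = 3 \<and>
           count \<mu> (2 ^ val2_entry \<mu> j) \<ge> 2)}"
  by (simp only: SPa'_eq_semi_padovan_partitions semi_padovan_partitions_def
      semi_padovan_iff_val2_seq)

end
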